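(* Let $p>0$ be a prime, let $\mathbb F$ be a field of characteristic $p$, and let $\mathfrak m_0(p)$ be the $p$-dimensional Lie algebra over $\mathbb F$ with basis $e_1,\dots,e_p$ and brackets $[e_1,e_i]=-[e_i,e_1]=e_{i+1}$ for $1<i<p$, all other brackets of basis elements being $0$. Then $\mathfrak m_0(p)$ admits the structure of a restricted Lie algebra. More precisely, for every $\lambda=(\lambda_1,\dots,\lambda_p)\in\mathbb F^p$, setting $e_k^{[p]}=\lambda_k e_p$ for $1\le k\le p$ defines a restricted Lie algebra structure on $\mathfrak m_0(p)$, whose $[p]$-operator is given for all $\alpha_1,\dots,\alpha_p\in\mathbb F$ by $$\Big(\sum_{k=1}^p\alpha_k e_k\Big)^{[p]}=\Big(\sum_{k=1}^p\alpha_k^p\lambda_k\Big)e_p .$$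
   Context: A restricted Lie algebra over a field $\mathbb F$ of characteristic $p>0$ is a Lie algebra $\mathfrak g$ with a map $g\mapsto g^{[p]}$ (the $[p]$-operator) such that $\operatorname{ad}(g^{[p]})=(\operatorname{ad} g)^p$, $(\alpha g)^{[p]}=\alpha^p g^{[p]}$, and $(g+h)^{[p]}=g^{[p]}+h^{[p]}+\sum_{i=1}^{p-1}s_i(g,h)$ for all $g,h\in\mathfrak g$, $\alpha\in\mathbb F$, where $i\,s_i(g,h)$ is the coefficient of $t^{i-1}$ in $(\operatorname{ad}(tg+h))^{p-1}(g)$. *)

theory Defs
  imports "HOL-Analysis.Cartesian_Space" "HOL-Computational_Algebra.Polynomial"
    "HOL-Computational_Algebra.Primes"
begin

locale lie_algebra = vector_space scl
  for scl :: "'a::field \<Rightarrow> 'v::ab_group_add \<Rightarrow> 'v" +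
  fixes bracket :: "'v \<Rightarrow> 'v \<Rightarrow> 'v"
  assumes linear_bracket_right: "Vector_Spaces.linear scl scl (\<lambda>y. bracket x y)"
    and linear_bracket_left: "Vector_Spaces.linear scl scl (\<lambda>x. bracket x y)"
    and bracket_self: "bracket x x = 0"
    and jacobi: "bracket x (bracket y z) + bracket y (bracket z x) + bracket z (bracket x y) = 0"

text \<open>An element of \<open>'v poly\<close> is read as a polynomial in \<open>t\<close> with coefficients in the Lie algebra,
  i.e. as an element of its extension of scalars to the polynomial ring.
  The bracket extends by \<open>[x t^i, y t^j] = [x, y] t^(i + j)\<close>.\<close>

definition bracket_poly :: "('v \<Rightarrow> 'v \<Rightarrow> 'v) \<Rightarrow> 'v poly \<Rightarrow> 'v poly \<Rightarrow> 'v::ab_group_add poly" where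
  "bracket_poly bracket X Y =
     (\<Sum>i\<le>degree X. \<Sum>j\<le>degree Y. monom (bracket (coeff X i) (coeff Y j)) (i + j))"

text \<open>The polynomial \<open>[:h, g:]\<close> is \<open>t g + h\<close>. For \<open>1 \<le> i < p\<close> the scalar \<open>i\<close> is invertible in
  characteristic \<open>p\<close>, so \<open>i s\<^sub>i(g, h)\<close> determines \<open>s\<^sub>i(g, h)\<close>.\<close>

definition jacobson_s ::
  "('a::field \<Rightarrow> 'v \<Rightarrow> 'v) \<Rightarrow> ('v \<Rightarrow> 'v \<Rightarrow> 'v) \<Rightarrow> nat \<Rightarrow> nat \<Rightarrow> 'v \<Rightarrow> 'v \<Rightarrow> 'v::ab_group_add" where
  "jacobson_s scl bracket p i g h =
     scl (inverse (of_nat i))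
       (coeff (((bracket_poly bracket [:h, g:]) ^^ (p - 1)) [:g:]) (i - 1))"

locale restricted_lie_algebra = lie_algebra scl bracket
  for scl :: "'a::field \<Rightarrow> 'v::ab_group_add \<Rightarrow> 'v"
    and bracket :: "'v \<Rightarrow> 'v \<Rightarrow> 'v" +
  fixes p :: nat
    and p_op :: "'v \<Rightarrow> 'v"
  assumes char_p: "CHAR('a) = p"
    and p_pos: "p > 0"
    and ad_p_op: "bracket (p_op g) = (bracket g) ^^ p"
    and p_op_scale: "p_op (scl a g) = scl (a ^ p) (p_op g)"
    and p_op_add: "p_op (g + h) = p_op g + p_op h + (\<Sum>i=1..p - 1. jacobson_s scl bracket p i g h)"

text \<open>A Lie algebra with a basis \<open>e 1, \<dots>, e n\<close> and the brackets of \<open>\<mm>\<^sub>0(n)\<close>; this fixes the Lie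
  algebra up to isomorphism. The values of \<open>e\<close> outside \<open>{1..n}\<close> are irrelevant.\<close>

locale m0_algebra = lie_algebra scl bracket
  for scl :: "'a::field \<Rightarrow> 'v::ab_group_add \<Rightarrow> 'v"
    and bracket :: "'v \<Rightarrow> 'v \<Rightarrow> 'v" +
  fixes n :: nat
    and e :: "nat \<Rightarrow> 'v"
  assumes inj_e: "inj_on e {1..n}"
    and independent_e: "independent (e ` {1..n})"
    and span_e: "span (e ` {1..n}) = UNIV"
    and bracket_e1: "1 < i \<Longrightarrow> i < n \<Longrightarrow> bracket (e 1) (e i) = e (i + 1)"
    and bracket_e1': "1 < i \<Longrightarrow> i < n \<Longrightarrow> bracket (e i) (e 1) = - e (i + 1)"
    and bracket_other: "i \<in> {1..n} \<Longrightarrow> j \<in> {1..n} \<Longrightarrow>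
       \<not> (i = 1 \<and> 1 < j \<and> j < n) \<Longrightarrow> \<not> (j = 1 \<and> 1 < i \<and> i < n) \<Longrightarrow> bracket (e i) (e j) = 0"

text \<open>The algebra exists, on the coordinate space, in every dimension.\<close>

lemma m0_algebra_exists:
  "\<exists>(bracket :: 'a::field ^ 'n \<Rightarrow> 'a ^ 'n \<Rightarrow> 'a ^ 'n) e. m0_algebra (*s) bracket CARD('n) e"
proof -
  let ?n = "CARD('n)"
  obtain f :: "nat \<Rightarrow> 'n" where f: "bij_betw f {1..?n} UNIV"
    using ex_bij_betw_nat_finite_1[of "UNIV :: 'n set"] by auto
  define ix where "ix = inv_into {1..?n} f"
  have ix: "ix (f i) = i" if "i \<in> {1..?n}" for i
    unfolding ix_def using f that by (simp add: bij_betw_def)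
  have fix': "f (ix k) = k" "ix k \<in> {1..?n}" for k
    unfolding ix_def using f
    by (metis UNIV_I bij_betw_imp_surj_on f_inv_into_f, metis UNIV_I bij_betw_imp_surj_on inv_into_into)
  have f_eq: "f i = f j \<longleftrightarrow> i = j" if "i \<in> {1..?n}" "j \<in> {1..?n}" for i j
    using ix that by metis
  define e :: "nat \<Rightarrow> 'a ^ 'n" where "e i = axis (f i) 1" for i
  define br :: "'a ^ 'n \<Rightarrow> 'a ^ 'n \<Rightarrow> 'a ^ 'n" where
    "br x y = (\<chi> k. if 3 \<le> ix k then x $ f 1 * y $ f (ix k - 1) - x $ f (ix k - 1) * y $ f 1 else 0)"
    for x y
  have br_nth: "br x y $ f i = (if 3 \<le> i then x $ f 1 * y $ f (i - 1) - x $ f (i - 1) * y $ f 1 else 0)"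
    if "i \<in> {1..?n}" for x y i
    using that by (simp add: br_def ix)
  have e_nth: "e i $ f j = (if i = j then 1 else 0)" if "i \<in> {1..?n}" "j \<in> {1..?n}" for i j
    using that f_eq by (auto simp: e_def axis_def)
  have eqI: "x = y" if "\<And>i. i \<in> {1..?n} \<Longrightarrow> x $ f i = y $ f i" for x y :: "'a ^ 'n"
    using that fix' by (metis vec_eq_iff)
  have n1: "1 \<in> {1..?n}" by (simp add: Suc_leI)
  have im: "e ` {1..?n} = cart_basis"
    using f unfolding e_def cart_basis_def bij_betw_def by (auto simp: image_iff; metis UNIV_I image_iff)
  have e_pred: "e i $ f (j - Suc 0) = (if Suc i = j then 1 else 0)"
    if "i \<in> {1..?n}" "j \<le> ?n" "3 \<le> j" for i j
  proof -
    have "j - 1 \<in> {1..?n}" "i = j - 1 \<longleftrightarrow> Suc i = j" using that by auto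
    then show ?thesis using e_nth[of i "j - 1"] that(1) by simp
  qed
  have "m0_algebra (*s) br ?n e"
  proof (unfold_locales, goal_cases)
    case (1 x b1 b2) then show ?case by (simp add: br_def vec_eq_iff algebra_simps)
  next
    case (2 x r b) then show ?case by (simp add: br_def vec_eq_iff algebra_simps)
  next
    case (3 y b1 b2) then show ?case by (simp add: br_def vec_eq_iff algebra_simps)
  next
    case (4 y r b) then show ?case by (simp add: br_def vec_eq_iff algebra_simps)
  next
    case (5 x) then show ?case by (simp add: br_def vec_eq_iff algebra_simps)
  next
    case (6 x y z)
    show ?case
    proof (rule eqI)
      fix i assume i: "i \<in> {1..?n}"
      have d: "i - 1 \<in> {1..?n}" if "3 \<le> i" using i that by auto
      show "(br x (br y z) + br y (br z x) + br z (br x y)) $ f i = 0 $ f i"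
        using i d n1 by (auto simp: br_nth algebra_simps)
    qed
  next
    case 7 show ?case by (rule inj_onI) (metis e_nth zero_neq_one)
  next
    case 8 show ?case unfolding im by (rule vec.independent_Basis)
  next
    case 9 show ?case unfolding im by (rule vec.span_Basis)
  next
    case (10 i)
    then show ?case using n1 by (intro eqI) (auto simp: br_nth e_nth e_pred)
  next
    case (11 i)
    then show ?case using n1 by (intro eqI) (auto simp: br_nth e_nth e_pred)
  next
    case (12 i j)
    then show ?case using n1 by (intro eqI) (auto simp: br_nth e_nth e_pred)
  qed
  then show ?thesis by blast
qed

end

theory Submission
  imports Defs
begin

text \<open>Bracketing with any element maps the whole algebra into the span of \<open>e 3, \<dots>, e p\<close>, and
  afterwards raises the lowest occurring index by one with every step. Hence any \<open>p - 1\<close> successive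
  brackets vanish, also after extending scalars to polynomials in \<open>t\<close>, so that all Jacobson terms
  \<open>s\<^sub>i(g, h)\<close> are zero and \<open>(ad g)\<^sup>p = 0\<close>. A \<open>[p]\<close>-operator is therefore the same thing as a
  \<open>p\<close>-semilinear map into the center, which contains \<open>e p\<close>; such a map is determined by its
  values on a basis, and these can be prescribed.\<close>

context lie_algebra
begin

text \<open>Each coefficient of the extended bracket is a finite sum of brackets of coefficients, so
  arguments about \<open>bracket\<close> carry over to polynomials in \<open>t\<close>.\<close>

lemma coeff_bracket_poly_mem:
  assumes "subspace S" "\<And>i j. bracket (coeff X i) (coeff Y j) \<in> S"
  shows "coeff (bracket_poly bracket X Y) k \<in> S"
  unfolding bracket_poly_def coeff_sum coeff_monom
  using assms by (auto intro!: subspace_sum subspace_0)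

lemma bracket_linear_simps:
  "bracket x (y + z) = bracket x y + bracket x z"
  "bracket x (scl a y) = scl a (bracket x y)"
  "bracket (x + y) z = bracket x z + bracket y z"
  "bracket (scl a x) z = scl a (bracket x z)"
  "bracket x 0 = 0"
  "bracket 0 z = 0"
proof -
  interpret R: Vector_Spaces.linear scl scl "\<lambda>y. bracket x y" by (rule linear_bracket_right)
  interpret L: Vector_Spaces.linear scl scl "\<lambda>x. bracket x z" by (rule linear_bracket_left)
  show "bracket x (y + z) = bracket x y + bracket x z"
    "bracket x (scl a y) = scl a (bracket x y)"
    "bracket (x + y) z = bracket x z + bracket y z"
    "bracket (scl a x) z = scl a (bracket x z)"
    "bracket x 0 = 0"
    "bracket 0 z = 0"
    by (fact R.add R.scale L.add L.scale R.zero L.zero)+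
qed

text \<open>By bilinearity, a span induction in each argument reduces the claim to
  generators.\<close>

lemma bracket_span_mem:
  assumes "subspace S" "\<And>a b. a \<in> A \<Longrightarrow> b \<in> B \<Longrightarrow> bracket a b \<in> S"
    and "x \<in> span A" "y \<in> span B"
  shows "bracket x y \<in> S"
  using assms(3)
proof (induction rule: span_induct_alt)
  case base
  then show ?case using assms(1) by (simp add: bracket_linear_simps subspace_0)
next
  case (step c a x)
  have "bracket a y \<in> S" using assms(4)
  proof (induction rule: span_induct_alt)
    case base
    then show ?case using assms(1) by (simp add: bracket_linear_simps subspace_0)
  next
    case (step d b y)
    then show ?case using assms(1,2) \<open>a \<in> A\<close>
      by (simp add: bracket_linear_simps subspace_add subspace_scale)
  qed
  then show ?case using step assms(1)
    by (simp add: bracket_linear_simps subspace_add subspace_scale)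
qed

end

context m0_algebra
begin

text \<open>These are the terms of the lower central series, indexed by the number of brackets
  taken. Stage 0 is separate because \<open>m + 2\<close> would start at \<open>e 2\<close> there
  and miss \<open>e 1\<close>.\<close>

definition filtration :: "nat \<Rightarrow> 'v set" where
  "filtration m = (if m = 0 then UNIV else span (e ` {m + 2..n}))"

lemma subspace_filtration: "subspace (filtration m)"
  by (simp add: filtration_def)

lemma filtration_eq_0: "0 < m \<Longrightarrow> n \<le> Suc m \<Longrightarrow> filtration m = {0}"
  by (simp add: filtration_def)

lemma bracket_basis_mem_filtration:
  assumes "i \<in> {1..n}" "j \<in> {1..n}" "m = 0 \<or> m + 2 \<le> j"
  shows "bracket (e i) (e j) \<in> span (e ` {Suc m + 2..n})"
proof -
  consider "i = 1" "1 < j" "j < n" | "j = 1" "1 < i" "i < n" | "bracket (e i) (e j) = 0"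
    using bracket_other assms by blast
  then show ?thesis
  proof cases
    case 1
    then show ?thesis using assms bracket_e1[of j] by (auto intro!: span_base)
  next
    case 2
    \<comment> \<open>Here \<open>j = 1\<close> forces \<open>m = 0\<close>, so it is enough that
      \<open>i + 1\<close> is at least 3.\<close>
    then show ?thesis using assms bracket_e1'[of i] by (auto intro!: span_base span_neg)
  qed (simp add: span_zero)
qed

lemma bracket_mem_filtration:
  assumes "y \<in> filtration m"
  shows "bracket x y \<in> filtration (Suc m)"
proof -
  have "bracket x y \<in> span (e ` {Suc m + 2..n})"
  proof (rule bracket_span_mem[where A = "e ` {1..n}"
        and B = "e ` {j \<in> {1..n}. m = 0 \<or> m + 2 \<le> j}"])
    show "y \<in> span (e ` {j \<in> {1..n}. m = 0 \<or> m + 2 \<le> j})"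
    proof (cases "m = 0")
      case True
      then have "{j \<in> {1..n}. m = 0 \<or> m + 2 \<le> j} = {1..n}" by auto
      then show ?thesis by (simp only: span_e UNIV_I)
    next
      case False
      then have "{j \<in> {1..n}. m = 0 \<or> m + 2 \<le> j} = {m + 2..n}" by auto
      then show ?thesis using assms False by (simp add: filtration_def)
    qed
    show "bracket a b \<in> span (e ` {Suc m + 2..n})"
      if "a \<in> e ` {1..n}" "b \<in> e ` {j \<in> {1..n}. m = 0 \<or> m + 2 \<le> j}" for a b
      using that bracket_basis_mem_filtration by blast
  qed (simp_all only: span_e UNIV_I subspace_span)
  then show ?thesis by (simp add: filtration_def)
qed

lemma ad_power_mem_filtration: "(bracket x ^^ m) y \<in> filtration m"
  by (induction m) (auto simp: bracket_mem_filtration filtration_def[of 0])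

lemma coeff_ad_poly_power_mem_filtration:
  "coeff ((bracket_poly bracket X ^^ m) Y) k \<in> filtration m"
proof (induction m arbitrary: k)
  case (Suc m)
  show ?case
    unfolding funpow.simps comp_apply
    by (rule coeff_bracket_poly_mem[OF subspace_filtration])
      (rule bracket_mem_filtration[OF Suc])
qed (simp add: filtration_def)

lemma ad_power_eq_0: "2 \<le> n \<Longrightarrow> (bracket x ^^ n) = (\<lambda>_. 0)"
  using ad_power_mem_filtration[of n] by (auto simp: filtration_eq_0)

text \<open>The \<open>n - 1\<close> brackets in the Jacobson terms just suffice: stage
  \<open>n - 1\<close> is spanned by the empty set. The bound \<open>2 \<le> n\<close> keeps this
  stage away from the exceptional stage 0.\<close>

lemma jacobson_s_eq_0: "2 \<le> n \<Longrightarrow> jacobson_s scl bracket n i g h = 0"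
  using coeff_ad_poly_power_mem_filtration[where X = "[:h, g:]" and m = "n - 1" and Y = "[:g:]" and k = "i - 1"]
  by (simp add: jacobson_s_def filtration_eq_0)

text \<open>The index \<open>n\<close> is neither 1 nor strictly below \<open>n\<close>, which rules
  out both kinds of nonzero bracket; hence \<open>e n\<close> is central.\<close>

lemma bracket_e_n_eq_0:
  assumes "2 \<le> n"
  shows "bracket (e n) y = 0"
proof -
  have "bracket (e n) y \<in> {0}"
  proof (rule bracket_span_mem[where A = "{e n}" and B = "e ` {1..n}"])
    show "bracket a b \<in> {0}" if "a \<in> {e n}" "b \<in> e ` {1..n}" for a b
      using that bracket_other[of n] assms by auto
  qed (simp_all only: span_e subspace_single_0 span_base UNIV_I singletonI)
  then show ?thesis by simp
qed

definition coord :: "'v \<Rightarrow> nat \<Rightarrow> 'a" where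
  "coord x k = representation (e ` {1..n}) x (e k)"

lemma sum_coord: "(\<Sum>k=1..n. scl (coord x k) (e k)) = x"
  using sum_representation_eq[OF independent_e, of x "e ` {1..n}"] inj_e
  by (simp add: span_e coord_def sum.reindex del: One_nat_def)

lemma coord_add: "coord (x + y) k = coord x k + coord y k"
  by (simp add: coord_def representation_add independent_e span_e del: One_nat_def)

lemma coord_scale: "coord (scl a x) k = a * coord x k"
  by (simp add: coord_def representation_scale independent_e span_e del: One_nat_def)

lemma coord_e: "j \<in> {1..n} \<Longrightarrow> k \<in> {1..n} \<Longrightarrow> coord (e j) k = (if k = j then 1 else 0)"
  by (simp add: coord_def representation_basis[OF independent_e] inj_on_eq_iff[OF inj_e]
      del: One_nat_def atLeastAtMost_iff)

text \<open>The operator of the theorem in coordinates. The dimension \<open>n\<close> also serves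
  as the exponent, since it is to equal the characteristic.\<close>

definition p_map :: "(nat \<Rightarrow> 'a) \<Rightarrow> 'v \<Rightarrow> 'v" where
  "p_map lam x = scl (\<Sum>k=1..n. coord x k ^ n * lam k) (e n)"

lemma p_map_e:
  assumes "k \<in> {1..n}"
  shows "p_map lam (e k) = scl (lam k) (e n)"
proof -
  have "(\<Sum>j=1..n. coord (e k) j ^ n * lam j) = (\<Sum>j=1..n. if j = k then lam j else 0)"
    using assms by (intro sum.cong) (auto simp: coord_e)
  then show ?thesis using assms by (simp add: p_map_def)
qed

lemma restricted_p_map:
  assumes "prime n" "CHAR('a) = n"
  shows "restricted_lie_algebra scl bracket n (p_map lam)"
proof (unfold_locales, goal_cases)
  case 1
  show ?case by (fact assms)
next
  case 2
  show ?case using assms(1) by (rule prime_gt_0_nat)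
next
  case (3 g)
  \<comment> \<open>Both sides are zero: the left by centrality of \<open>e n\<close>, the right by
    nilpotency.\<close>
  show ?case using prime_ge_2_nat[OF assms(1)]
    by (simp add: fun_eq_iff ad_power_eq_0 p_map_def bracket_linear_simps bracket_e_n_eq_0)
next
  case (4 a g)
  show ?case
    by (simp add: p_map_def coord_scale power_mult_distrib sum_distrib_left mult.assoc)
next
  case (5 g h)
  \<comment> \<open>Without Jacobson terms the axiom is plain additivity, which is additivity of
    Frobenius on each coordinate.\<close>
  have "(coord g k + coord h k) ^ n = coord g k ^ n + coord h k ^ n" for k
    using assms by (intro freshmans_dream) simp_all
  then show ?case using prime_ge_2_nat[OF assms(1)]
    by (simp add: p_map_def coord_add jacobson_s_eq_0 distrib_right sum.distrib scale_left_distrib)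
qed

text \<open>The Jacobson terms vanish for every restricted structure, so each \<open>p_op\<close> is
  additive and hence semilinear over Frobenius.\<close>

lemma restricted_p_op_sum:
  assumes "2 \<le> n" "restricted_lie_algebra scl bracket n p_op"
  shows "p_op (\<Sum>k\<in>A. scl (\<alpha> k) (f k)) = (\<Sum>k\<in>A. scl (\<alpha> k ^ n) (p_op (f k)))"
proof -
  interpret R: restricted_lie_algebra scl bracket n p_op by fact
  have add: "p_op (g + h) = p_op g + p_op h" for g h
    using R.p_op_add[of g h] assms(1) by (simp add: jacobson_s_eq_0)
  \<comment> \<open>This covers the empty sum, and also infinite \<open>A\<close>, where both sums
    are 0 by convention.\<close>
  have "p_op 0 = 0" using add[of 0 0] by simp
  then show ?thesis
    by (induction A rule: infinite_finite_induct) (simp_all add: add R.p_op_scale)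
qed

lemma restricted_p_op_formula:
  assumes "2 \<le> n" "restricted_lie_algebra scl bracket n p_op"
    and "\<And>k. k \<in> {1..n} \<Longrightarrow> p_op (e k) = scl (lam k) (e n)"
  shows "p_op (\<Sum>k=1..n. scl (\<alpha> k) (e k)) = scl (\<Sum>k=1..n. \<alpha> k ^ n * lam k) (e n)"
  using assms by (simp add: restricted_p_op_sum scale_sum_left)

end

theorem mainTheorem1:
  fixes scl :: "'a::field \<Rightarrow> 'v::ab_group_add \<Rightarrow> 'v"
    and bracket :: "'v \<Rightarrow> 'v \<Rightarrow> 'v"
    and e :: "nat \<Rightarrow> 'v"
    and p :: nat
  assumes "prime p"
    and "CHAR('a) = p"
    and "m0_algebra scl bracket p e"
  shows "(\<exists>p_op. restricted_lie_algebra scl bracket p p_op) \<and>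
    (\<forall>lam :: nat \<Rightarrow> 'a.
       (\<exists>!p_op. restricted_lie_algebra scl bracket p p_op \<and>
          (\<forall>k\<in>{1..p}. p_op (e k) = scl (lam k) (e p))) \<and>
       (\<forall>p_op. restricted_lie_algebra scl bracket p p_op \<and>
          (\<forall>k\<in>{1..p}. p_op (e k) = scl (lam k) (e p)) \<longrightarrow>
          (\<forall>\<alpha> :: nat \<Rightarrow> 'a.
             p_op (\<Sum>k=1..p. scl (\<alpha> k) (e k)) = scl (\<Sum>k=1..p. \<alpha> k ^ p * lam k) (e p))))"
proof -
  interpret m0_algebra scl bracket p e by fact
  have p2: "2 \<le> p" using assms(1) by (rule prime_ge_2_nat)
  have restr: "restricted_lie_algebra scl bracket p (p_map lam)" for lam
    using assms(1,2) by (rule restricted_p_map)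
  have "p_op = p_map lam"
    if "restricted_lie_algebra scl bracket p p_op" "\<forall>k\<in>{1..p}. p_op (e k) = scl (lam k) (e p)"
    for p_op lam
  proof
    fix x
    \<comment> \<open>With the coordinates of \<open>x\<close> as coefficients, the formula for
      \<open>p_op\<close> becomes the definition of \<open>p_map\<close>.\<close>
    show "p_op x = p_map lam x"
      using restricted_p_op_formula[OF p2 that(1), of lam "coord x"] that(2)
      unfolding sum_coord p_map_def by blast
  qed
  then have "\<exists>!p_op. restricted_lie_algebra scl bracket p p_op \<and>
      (\<forall>k\<in>{1..p}. p_op (e k) = scl (lam k) (e p))" for lam
    using restr p_map_e by (intro ex1I[of _ "p_map lam"]) auto
  then show ?thesis
    using restr restricted_p_op_formula[OF p2] by blast
qed

end
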